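(* Let $n\ge 3$ and $m\ge 1$ be integers, let $B_0,B_1,\dots,B_m,A_1,A_2,A_3$ be real symmetric $n\times n$ matrices and let $\beta_0,\beta_1,\dots,\beta_m\in\mathbb{R}$. Suppose that $\{B_i: i=0,1,\dots,m\}$ can be generated by $\{A_1,A_2,A_3\}$, i.e. there exist real numbers $r_{ij}$ ($i=0,\dots,m$, $j=1,2,3$) with $B_i=\sum_{j=1}^3 r_{ij}A_j$ for every $i=0,1,\dots,m$, and that $s_1A_1+s_2A_2+s_3A_3\succ 0$ for some $s_1,s_2,s_3\in\mathbb{R}$. Assume the Slater condition: there exists $\bar x\in\mathbb{R}^n$ such that $\bar x^TB_i\bar x<\beta_i$ for $i=1,\dots,m$. Then the following two assertions are equivalent: (e) for every $x\in\mathbb{R}^n$: if $x^TB_ix\le\beta_i$ for all $i=1,\dots,m$, then $x^TB_0x\ge\beta_0$; (f) there exists $t\in\mathbb{R}^m$ with $t_i\ge 0$ for $i=1,\dots,m$ such that $$B_0+\sum_{i=1}^m t_iB_i\succeq 0\quad\text{and}\quad \beta_0+\sum_{i=1}^m t_i\beta_i\le 0.$$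
   Context: For a real symmetric matrix $A$, $A\succ 0$ (respectively $A\succeq 0$) means that $A$ is positive definite (respectively positive semidefinite). *)

theory Defs
  imports "HOL-Analysis.Analysis"
begin

definition symmetric_matrix :: "real ^ 'n ^ 'n \<Rightarrow> bool" where
  "symmetric_matrix A \<longleftrightarrow> transpose A = A"

definition quad_form :: "real ^ 'n ^ 'n \<Rightarrow> real ^ 'n \<Rightarrow> real" where
  "quad_form A x = x \<bullet> (A *v x)"

definition pos_def :: "real ^ 'n ^ 'n \<Rightarrow> bool" where
  "pos_def A \<longleftrightarrow> symmetric_matrix A \<and> (\<forall>x. x \<noteq> 0 \<longrightarrow> quad_form A x > 0)"

definition pos_semidef :: "real ^ 'n ^ 'n \<Rightarrow> bool" where
  "pos_semidef A \<longleftrightarrow> symmetric_matrix A \<and> (\<forall>x. quad_form A x \<ge> 0)"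

end

(* The joint range K of the three quadratic forms x^T A_j x is a convex cone (Polyak), because
   the dimension is at least three and some combination is positive definite. On K the problem
   is a convex program with affine data, so Slater's condition yields Lagrange multipliers;
   since K is a cone, the resulting Lagrangian inequality splits into the matrix inequality
   and the inequality for its value at 0. Convexity of K reduces to the solvability of
   z^2 + a z + c conj(z) + d = 0 over the complex numbers, which avoids any degree theory. *)

theory Submission
  imports Defs
begin

section \<open>Quadratic equations in a complex number and its conjugate\<close>

text \<open>For \<open>z = x + i y\<close> the real and imaginary parts are two real conics. If
  \<open>Im d = 0\<close>, one of the lines \<open>y = 0\<close> and \<open>x = c / 2\<close>
  carries a solution; otherwise eliminating \<open>y\<close> leaves a quartic in \<open>x\<close>
  with a sign change to the right of \<open>c / 2\<close>.\<close>

lemma conj_quadratic_root_real: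
  fixes c :: real and d :: complex
  assumes "c \<ge> 0"
  shows "\<exists>z. z\<^sup>2 + of_real c * cnj z + d = 0"
proof -
  have red: "\<exists>z. z\<^sup>2 + of_real c * cnj z + d = 0"
    if "x\<^sup>2 - y\<^sup>2 + c * x + Re d = 0" "2 * x * y - c * y + Im d = 0" for x y
    using that by (intro exI[of _ "Complex x y"]) (simp add: complex_eq_iff power2_eq_square)
  show ?thesis
  proof (cases "Im d = 0")
    case True
    show ?thesis
    proof (cases "Re d \<le> c\<^sup>2 / 4")
      case True
      define x where "x = sqrt (c\<^sup>2 / 4 - Re d) - c / 2"
      have "(x + c / 2)\<^sup>2 = c\<^sup>2 / 4 - Re d"
        using True by (simp add: x_def)
      then have "x\<^sup>2 + c * x + Re d = 0"
        by (simp add: power2_eq_square algebra_simps)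
      then show ?thesis
        using red[of x 0] \<open>Im d = 0\<close> by simp
    next
      case False
      then have "Re d \<ge> 0"
        by (smt (verit) divide_nonneg_pos zero_le_power2)
      \<comment> \<open>On the line \<open>x = c / 2\<close> the imaginary part vanishes for every
        \<open>y\<close>, so \<open>y\<close> only has to solve the real part.\<close>
      define y where "y = sqrt (3 * c\<^sup>2 / 4 + Re d)"
      have "y\<^sup>2 = 3 * c\<^sup>2 / 4 + Re d"
        using \<open>Re d \<ge> 0\<close> by (simp add: y_def)
      then show ?thesis
        using red[of "c / 2" y] \<open>Im d = 0\<close> by (simp add: power2_eq_square algebra_simps)
    qed
  next
    case False
    \<comment> \<open>The real part after substituting \<open>y = - Im d / (2 * x - c)\<close> from
      the imaginary part, cleared of denominators.\<close>
    define f where "f x = (x\<^sup>2 + c * x + Re d) * (2 * x - c)\<^sup>2 - (Im d)\<^sup>2" for x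
    \<comment> \<open>Large enough that the first factor of \<open>f M\<close> is at least 1 and the
      second at least \<open>(Im d)\<^sup>2\<close>.\<close>
    define M where "M = c / 2 + \<bar>Re d\<bar> + \<bar>Im d\<bar> + 1"
    have "f (c / 2) < 0"
      using False by (simp add: f_def)
    have "f M \<ge> 0"
    proof -
      have M: "M \<ge> 1" "2 * M - c \<ge> 2 * \<bar>Im d\<bar>" "M \<ge> \<bar>Re d\<bar>" "2 * M - c \<ge> 1"
        using assms by (auto simp: M_def)
      have "c * M \<ge> 0"
        using assms M by simp
      have "M\<^sup>2 + c * M + Re d \<ge> 1"
      proof -
        have "M * M \<ge> (\<bar>Re d\<bar> + 1) * M"
          using M assms by (intro mult_right_mono) (auto simp: M_def)
        moreover have "(\<bar>Re d\<bar> + 1) * M \<ge> (\<bar>Re d\<bar> + 1) * 1"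
          using M by (intro mult_left_mono) auto
        ultimately have "M * M \<ge> \<bar>Re d\<bar> + 1"
          using order.trans by fastforce
        then show ?thesis
          using \<open>c * M \<ge> 0\<close> unfolding power2_eq_square by linarith
      qed
      moreover have "(2 * M - c)\<^sup>2 \<ge> (Im d)\<^sup>2"
        using M by (intro iffD1[OF abs_le_square_iff]) auto
      ultimately have "(M\<^sup>2 + c * M + Re d) * (2 * M - c)\<^sup>2 \<ge> 1 * (Im d)\<^sup>2"
        by (intro mult_mono) auto
      then show ?thesis
        by (simp add: f_def)
    qed
    moreover have "continuous_on {c / 2..M} f"
      unfolding f_def by (intro continuous_intros)
    moreover have "c / 2 \<le> M"
      by (simp add: M_def)
    ultimately obtain x where x: "c / 2 \<le> x" "x \<le> M" "f x = 0"
      using IVT'[of f "c / 2" 0 M] \<open>f (c / 2) < 0\<close> by auto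
    then have ne: "2 * x - c \<noteq> 0"
      using False by (auto simp: f_def)
    define y where "y = - Im d / (2 * x - c)"
    have y: "y * (2 * x - c) = - Im d"
      using ne by (simp add: y_def)
    have "(x\<^sup>2 + c * x + Re d) * (2 * x - c)\<^sup>2 = (y * (2 * x - c))\<^sup>2"
      using x unfolding y f_def by simp
    then have "x\<^sup>2 + c * x + Re d = y\<^sup>2"
      using ne by (simp add: power_mult_distrib)
    then show ?thesis
      using red[of x y] y by (simp add: algebra_simps)
  qed
qed

text \<open>The shift by \<open>a / 2\<close> removes the linear term; the rotation by a cube root of the phase of \<open>c\<close>
  makes the coefficient of \<open>cnj z\<close> real.\<close>

lemma conj_quadratic_root:
  fixes a c d :: complex
  shows "\<exists>z. z\<^sup>2 + a * z + c * cnj z + d = 0"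
proof -
  \<comment> \<open>The constant term left after substituting \<open>w * u - a / 2\<close> for
    \<open>z\<close>.\<close>
  define e where "e = d - a\<^sup>2 / 4 - c * cnj a / 2"
  define w where "w = cis (Arg c / 3)"
  have w3: "w ^ 3 = cis (Arg c)"
    unfolding w_def Complex.DeMoivre by simp
  have ww: "w * cnj w = 1"
    by (simp add: w_def cis_cnj flip: cis_inverse)
  have c: "c = of_real (cmod c) * w ^ 3"
    unfolding w3 using rcis_cmod_Arg[of c] by (simp add: rcis_def)
  obtain u where u: "u\<^sup>2 + of_real (cmod c) * cnj u + e * (cnj w)\<^sup>2 = 0"
    using conj_quadratic_root_real[of "cmod c"] by auto
  have "(w * u)\<^sup>2 + c * cnj (w * u) + e
      = w\<^sup>2 * (u\<^sup>2 + of_real (cmod c) * cnj u + e * (cnj w)\<^sup>2)"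
  proof -
    have "c * cnj (w * u) = of_real (cmod c) * w\<^sup>2 * (w * cnj w) * cnj u"
      by (subst c) (simp add: power2_eq_square power3_eq_cube)
    moreover have "w\<^sup>2 * (u\<^sup>2 + of_real (cmod c) * cnj u + e * (cnj w)\<^sup>2)
        = (w * u)\<^sup>2 + of_real (cmod c) * w\<^sup>2 * cnj u + e * (w * cnj w)\<^sup>2"
      by (simp add: distrib_left power_mult_distrib ac_simps)
    ultimately show ?thesis
      by (simp add: ww)
  qed
  then have "(w * u)\<^sup>2 + c * cnj (w * u) + e = 0"
    using u by simp
  moreover have "(w * u - a / 2)\<^sup>2 + a * (w * u - a / 2) + c * cnj (w * u - a / 2) + d
      = (w * u)\<^sup>2 + c * cnj (w * u) + e"
    by (simp add: e_def power2_eq_square field_simps)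
  ultimately show ?thesis
    by metis
qed

text \<open>The leading parts are the real and imaginary parts of \<open>z\<^sup>2\<close>, and
  every real linear map of the complex plane is a combination of \<open>z\<close> and
  \<open>cnj z\<close> with complex coefficients, so the pair is one equation in
  \<open>z\<close>.\<close>

lemma real_conics_intersect:
  fixes p1 q1 d1 p2 q2 d2 :: real
  shows "\<exists>a b. a\<^sup>2 - b\<^sup>2 + p1 * a + q1 * b + d1 = 0 \<and> 2 * a * b + p2 * a + q2 * b + d2 = 0"
proof -
  obtain z where "z\<^sup>2 + Complex ((p1 + q2) / 2) ((p2 - q1) / 2) * z
      + Complex ((p1 - q2) / 2) ((p2 + q1) / 2) * cnj z + Complex d1 d2 = 0"
    using conj_quadratic_root by blast
  then have "(Re z)\<^sup>2 - (Im z)\<^sup>2 + p1 * Re z + q1 * Im z + d1 = 0 \<and>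
      2 * Re z * Im z + p2 * Re z + q2 * Im z + d2 = 0"
    by (simp add: complex_eq_iff power2_eq_square field_simps)
  then show ?thesis
    by blast
qed

section \<open>Convexity of the joint range of three quadratic forms\<close>

text \<open>A suitable multiple of any nonzero symmetric 2 by 2 matrix turns the identity into a
  positive semidefinite matrix of rank at most one: divide by the eigenvalue of largest modulus.\<close>

lemma identity_shift_rank_one:
  fixes a b c :: real
  assumes "a \<noteq> 0 \<or> b \<noteq> 0 \<or> c \<noteq> 0"
  shows "\<exists>t p q. p\<^sup>2 = 1 + t * a \<and> q\<^sup>2 = 1 + t * c \<and> p * q = t * b"
proof -
  have pos: "\<exists>t p q. p\<^sup>2 = 1 + t * a \<and> q\<^sup>2 = 1 + t * c \<and> p * q = t * b"
    if ne: "a \<noteq> 0 \<or> b \<noteq> 0 \<or> c \<noteq> 0" and tr: "a + c \<ge> 0" for a b c :: real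
  proof -
    define r where "r = sqrt (((a - c) / 2)\<^sup>2 + b\<^sup>2)"
    \<comment> \<open>The larger eigenvalue of the matrix with rows \<open>(a, b)\<close> and
      \<open>(b, c)\<close>; nonnegative trace makes it positive. The factor sought is
      \<open>t = - 1 / l\<close>, and \<open>det\<close> below is the characteristic
      equation.\<close>
    define l where "l = (a + c) / 2 + r"
    have r2: "r\<^sup>2 = ((a - c) / 2)\<^sup>2 + b\<^sup>2"
      by (simp add: r_def)
    have r_ge: "r \<ge> (a - c) / 2" "r \<ge> (c - a) / 2" "r \<ge> 0"
    proof -
      have "\<bar>(a - c) / 2\<bar> \<le> r"
        unfolding r_def by (rule real_le_rsqrt) (simp add: power_divide)
      then show "r \<ge> (a - c) / 2" "r \<ge> (c - a) / 2" "r \<ge> 0"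
        by (auto simp: abs_le_iff field_simps)
    qed
    have "l > 0"
    proof (rule ccontr)
      assume "\<not> l > 0"
      then have "r \<le> 0" and "a + c \<le> 0"
        using r_ge(3) tr by (simp_all add: l_def field_simps)
      then have "r = 0" and "c = - a"
        using r_ge(3) tr by simp_all
      then show False
        using ne r2 by simp
    qed
    have la: "l - a \<ge> 0" and lc: "l - c \<ge> 0"
      using r_ge by (simp_all add: l_def field_simps)
    have det: "(l - a) * (l - c) = b\<^sup>2"
    proof -
      have "(l - a) * (l - c) = r\<^sup>2 - ((a - c) / 2)\<^sup>2"
        by (simp add: l_def power2_eq_square field_simps)
      then show ?thesis
        using r2 by simp
    qed
    define p where "p = sqrt ((l - a) / l)"
    \<comment> \<open>The characteristic equation fixes \<open>p * q\<close> only up to sign; this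
      choice gives \<open>- b / l\<close>.\<close>
    define q where "q = (if b > 0 then - 1 else 1) * sqrt ((l - c) / l)"
    have "sqrt ((l - a) / l) * sqrt ((l - c) / l) = \<bar>b\<bar> / l"
    proof -
      have "sqrt ((l - a) / l) * sqrt ((l - c) / l) = sqrt (b\<^sup>2 / l\<^sup>2)"
        by (simp add: det power2_eq_square[of l] flip: real_sqrt_mult)
      then show ?thesis
        using \<open>l > 0\<close> by (simp add: real_sqrt_divide)
    qed
    then have "p * q = - (1 / l) * b"
      by (auto simp: p_def q_def)
    moreover have "p\<^sup>2 = 1 + - (1 / l) * a"
      using \<open>l > 0\<close> la by (simp add: p_def diff_divide_distrib)
    moreover have "q\<^sup>2 = 1 + - (1 / l) * c"
      using \<open>l > 0\<close> lc by (simp add: q_def power_mult_distrib diff_divide_distrib)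
    ultimately show ?thesis
      by blast
  qed
  show ?thesis
  proof (cases "a + c \<ge> 0")
    case True
    then show ?thesis
      using pos assms by blast
  next
    case False
    then obtain t p q where "p\<^sup>2 = 1 + t * (- a)" "q\<^sup>2 = 1 + t * (- c)" "p * q = t * (- b)"
      using pos[of "- a" "- b" "- c"] assms by auto
    then show ?thesis
      by (intro exI[of _ "- t"] exI[of _ p] exI[of _ q]) auto
  qed
qed

lemma symmetric_bilinear_combination:
  fixes h :: "'a::real_vector \<Rightarrow> 'a \<Rightarrow> 'b::real_vector"
  assumes "bilinear h" and "\<And>u v. h u v = h v u"
  shows "h (a *\<^sub>R x + b *\<^sub>R y) (a *\<^sub>R x + b *\<^sub>R y)
    = a\<^sup>2 *\<^sub>R h x x + (2 * a * b) *\<^sub>R h x y + b\<^sup>2 *\<^sub>R h y y"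
proof -
  note bil = bilinear_ladd[OF assms(1)] bilinear_radd[OF assms(1)]
    bilinear_lmul[OF assms(1)] bilinear_rmul[OF assms(1)]
  have "h (a *\<^sub>R x + b *\<^sub>R y) (a *\<^sub>R x + b *\<^sub>R y)
    = (a * a) *\<^sub>R h x x + ((a * b) *\<^sub>R h x y + (a * b) *\<^sub>R h x y) + (b * b) *\<^sub>R h y y"
    by (simp add: bil assms(2)[of y x] algebra_simps)
  then show ?thesis
    by (simp add: power2_eq_square flip: scaleR_add_left)
qed

text \<open>The joint range of three quadratic forms with a positive definite combination is convex in
  dimension at least three. In the nondegenerate case, \<open>h x x + h y y\<close> spans the common kernel of two
  coordinates on \<^typ>\<open>real ^ 3\<close>; it therefore suffices to find a common zero of two quadratic forms,
  looked for on an affine plane parallel to the span of \<open>x\<close> and \<open>y\<close>.\<close>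

lemma joint_range_add:
  fixes h :: "'a::euclidean_space \<Rightarrow> 'a \<Rightarrow> real ^ 3" and s :: "real ^ 3 \<Rightarrow> real"
  assumes dim: "DIM('a) \<ge> 3"
    and bil: "bilinear h" and sym: "\<And>u v. h u v = h v u"
    and lin: "linear s" and pos: "\<And>z. z \<noteq> 0 \<Longrightarrow> s (h z z) > 0"
  shows "\<exists>z. h z z = h x x + h y y"
proof -
  note comb = symmetric_bilinear_combination[OF bil sym]
  define T :: "real ^ 3 \<Rightarrow> real ^ 3"
    where "T v = (v $ 1) *\<^sub>R h x x + (v $ 2) *\<^sub>R h x y + (v $ 3) *\<^sub>R h y y" for v
  have linT: "linear T"
    unfolding T_def by (intro linearI) (simp_all add: algebra_simps)
  show ?thesis
  proof (cases "inj T")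
    case False
    then obtain v where v: "T v = 0" "v \<noteq> 0"
      using linT linear_injective_0 by blast
    then have "v $ 1 \<noteq> 0 \<or> v $ 2 / 2 \<noteq> 0 \<or> v $ 3 \<noteq> 0"
      by (auto simp: vec_eq_iff forall_3)
    \<comment> \<open>The off-diagonal entry is halved because the coefficient of
      \<open>h x y\<close> in the expansion is \<open>2 * p * q\<close>.\<close>
    then obtain t p q where
      t: "p\<^sup>2 = 1 + t * v $ 1" "q\<^sup>2 = 1 + t * v $ 3" "p * q = t * (v $ 2 / 2)"
      using identity_shift_rank_one by blast
    have "h (p *\<^sub>R x + q *\<^sub>R y) (p *\<^sub>R x + q *\<^sub>R y) = h x x + h y y + t *\<^sub>R T v"
      unfolding comb t using t(3) by (simp add: T_def algebra_simps)
    then show ?thesis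
      using v by auto
  next
    case True
    then obtain S where S: "linear S" "\<And>v. S (T v) = v" "\<And>v. T (S v) = v"
      using linear_injective_isomorphism[OF linT] by blast
    \<comment> \<open>Here the dimension enters: the plane through \<open>w\<close> parallel to
      \<open>span {x, y}\<close> misses the origin, so the common zero found on it is
      nonzero.\<close>
    have "\<exists>w. w \<notin> span {x, y}"
    proof (rule ccontr)
      assume "\<not> ?thesis"
      then have "span {x, y} = UNIV"
        by blast
      then have "DIM('a) \<le> card {x, y}"
        by (metis dim_UNIV dim_le_card' dim_span finite.emptyI finite.insertI)
      also have "\<dots> \<le> 2"
        by (simp add: card_insert_if)
      finally show False
        using dim by simp
    qed
    then obtain w where w: "w \<notin> span {x, y}"
      by blast
    have Sb: "S (h x x) = vector [1, 0, 0]" "S (h x y) = vector [0, 1, 0]"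
      "S (h y y) = vector [0, 0, 1]"
      using S(2)[of "vector [1, 0, 0]"] S(2)[of "vector [0, 1, 0]"] S(2)[of "vector [0, 0, 1]"]
      by (simp_all add: T_def)
    \<comment> \<open>Coordinates of \<open>h\<close> with respect to the basis
      \<open>h x x\<close>, \<open>h x y\<close>, \<open>h y y\<close>.\<close>
    define g where "g k u v = S (h u v) $ k" for k u v
    have g_bil: "bilinear (g k)" for k
      using bil S(1) unfolding bilinear_def g_def
      by (simp add: linear_iff)
    have g_sym: "g k u v = g k v u" for k u v
      by (simp add: g_def sym)
    have g_comb: "g k (a *\<^sub>R x + b *\<^sub>R y + w) (a *\<^sub>R x + b *\<^sub>R y + w)
        = a\<^sup>2 * g k x x + 2 * a * b * g k x y + b\<^sup>2 * g k y y
          + 2 * a * g k x w + 2 * b * g k y w + g k w w" for k a b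
    proof -
      have "g k (a *\<^sub>R x + b *\<^sub>R y + w) (a *\<^sub>R x + b *\<^sub>R y + w)
        = g k (a *\<^sub>R x + b *\<^sub>R y) (a *\<^sub>R x + b *\<^sub>R y)
          + 2 * g k (a *\<^sub>R x + b *\<^sub>R y) w + g k w w"
        using symmetric_bilinear_combination[OF g_bil g_sym, of k 1 "a *\<^sub>R x + b *\<^sub>R y" 1 w] by simp
      then show ?thesis
        unfolding symmetric_bilinear_combination[OF g_bil g_sym]
        by (simp add: bilinear_ladd[OF g_bil] bilinear_lmul[OF g_bil] algebra_simps)
    qed
    \<comment> \<open>These are \<open>g 1 z z = g 3 z z\<close> and \<open>g 2 z z = 0\<close> on
      the affine plane; by \<open>Sb\<close> their leading parts are
      \<open>a\<^sup>2 - b\<^sup>2\<close> and \<open>2 * a * b\<close>.\<close>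
    obtain a b where ab:
      "a\<^sup>2 - b\<^sup>2 + (2 * g 1 x w - 2 * g 3 x w) * a + (2 * g 1 y w - 2 * g 3 y w) * b
        + (g 1 w w - g 3 w w) = 0"
      "2 * a * b + (2 * g 2 x w) * a + (2 * g 2 y w) * b + g 2 w w = 0"
      using real_conics_intersect by blast
    define z where "z = a *\<^sub>R x + b *\<^sub>R y + w"
    have "z \<noteq> 0"
    proof
      assume "z = 0"
      then have "w = (- a) *\<^sub>R x + (- b) *\<^sub>R y"
        unfolding z_def by (simp add: eq_neg_iff_add_eq_0 algebra_simps)
      moreover have "\<dots> \<in> span {x, y}"
        by (intro span_add span_scale span_base) auto
      ultimately show False
        using w by simp
    qed
    have "g 1 z z = g 3 z z" "g 2 z z = 0"
      using ab unfolding z_def g_comb by (simp_all add: g_def Sb algebra_simps)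
    then have "T (S (h z z)) = g 1 z z *\<^sub>R (h x x + h y y)"
      by (simp add: T_def g_def algebra_simps)
    then have hz: "h z z = g 1 z z *\<^sub>R (h x x + h y y)"
      by (simp add: S)
    \<comment> \<open>It remains to see that the factor \<open>g 1 z z\<close> is positive:
      \<open>s\<close> is positive both at \<open>h z z\<close> and at \<open>h x x + h y y\<close>.
      Rescaling \<open>z\<close> then removes it.\<close>
    have "x \<noteq> 0"
      using Sb(1) S(1) bilinear_lzero[OF bil] linear_0 by (metis vector_3(1) zero_index zero_neq_one)
    have "s (h y y) \<ge> 0"
      using pos[of y] bilinear_lzero[OF bil] linear_0[OF lin] by (cases "y = 0") auto
    then have "s (h x x + h y y) > 0"
      using pos[OF \<open>x \<noteq> 0\<close>] by (simp add: linear_add[OF lin])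
    moreover have "s (h z z) = g 1 z z * s (h x x + h y y)"
      by (subst hz) (simp add: linear_scale[OF lin])
    ultimately have "g 1 z z > 0"
      using pos[OF \<open>z \<noteq> 0\<close>] by (metis zero_less_mult_pos2)
    define c where "c = 1 / sqrt (g 1 z z)"
    have "h (c *\<^sub>R z) (c *\<^sub>R z) = c\<^sup>2 *\<^sub>R h z z"
      by (simp add: bilinear_lmul[OF bil] bilinear_rmul[OF bil] power2_eq_square)
    also have "\<dots> = (c\<^sup>2 * g 1 z z) *\<^sub>R (h x x + h y y)"
      by (subst hz) simp
    also have "\<dots> = h x x + h y y"
      using \<open>g 1 z z > 0\<close> by (simp add: c_def power_divide)
    finally show ?thesis
      by blast
  qed
qed

section \<open>Lagrange multipliers for convex functions\<close>

text \<open>Multipliers are introduced one constraint at a time, so that no separation theorem in a space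
  of variable dimension is needed.\<close>

lemma lagrange_multiplier_single:
  fixes f g :: "'a::real_vector \<Rightarrow> real"
  assumes f: "convex_on K f" and g: "convex_on K g"
    and "x0 \<in> K" "g x0 < 0"
    and nonneg: "\<And>x. x \<in> K \<Longrightarrow> g x \<le> 0 \<Longrightarrow> f x \<ge> 0"
  shows "\<exists>t\<ge>0. \<forall>x\<in>K. f x + t * g x \<ge> 0"
proof -
  \<comment> \<open>Points with \<open>g x > 0\<close> bound the multiplier from below by these
    quotients, points with \<open>g y < 0\<close> bound it from above; \<open>bound\<close> says
    that the two kinds are compatible.\<close>
  define P where "P = {- f x / g x | x. x \<in> K \<and> g x > 0}"
  have bound: "p \<le> f y / - g y" if p: "p \<in> insert 0 P" and "y \<in> K" "g y < 0" for p y
  proof (cases "p = 0")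
    case True
    then show ?thesis
      using nonneg[OF \<open>y \<in> K\<close>] \<open>g y < 0\<close> by (simp add: divide_nonneg_neg divide_nonpos_neg)
  next
    case False
    then obtain x where x: "x \<in> K" "g x > 0" "p = - f x / g x"
      using p by (auto simp: P_def)
    \<comment> \<open>The weight at which the linear interpolation between \<open>g x\<close> and
      \<open>g y\<close> is zero, so that convexity makes the intermediate point feasible.\<close>
    define u where "u = g x / (g x - g y)"
    have d: "g x - g y > 0"
      using x that by simp
    have u: "0 \<le> u" "u \<le> 1" "1 - u = - g y / (g x - g y)"
      using d x that by (auto simp: u_def field_simps)
    let ?z = "(1 - u) *\<^sub>R x + u *\<^sub>R y"
    have "?z \<in> K"
      using convexD[OF convex_on_imp_convex[OF f] x(1) that(2), of "1 - u" u] u by simp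
    moreover have "g ?z \<le> (1 - u) * g x + u * g y"
      using convex_onD[OF g u(1,2)] x that by blast
    moreover have "(1 - u) * g x + u * g y = 0"
      unfolding u(3) by (simp add: u_def)
    ultimately have "0 \<le> f ?z"
      using nonneg by simp
    also have "\<dots> \<le> (1 - u) * f x + u * f y"
      using convex_onD[OF f u(1,2)] x that by blast
    also have "\<dots> = (- g y * f x + g x * f y) / (g x - g y)"
      unfolding u(3) by (simp add: u_def diff_divide_distrib)
    finally have "- g y * f x + g x * f y \<ge> 0"
      using d by (simp add: zero_le_divide_iff)
    then show ?thesis
      unfolding x(3) using x(2) that(3) by (simp add: field_simps)
  qed
  define t where "t = Sup (insert 0 P)"
  have bdd: "bdd_above (insert 0 P)"
    using bound[OF _ \<open>x0 \<in> K\<close> \<open>g x0 < 0\<close>] by (intro bdd_aboveI) blast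
  have "t \<ge> 0"
    unfolding t_def by (rule cSup_upper[OF _ bdd]) simp
  moreover have "f x + t * g x \<ge> 0" if "x \<in> K" for x
  proof (cases "g x" "0 :: real" rule: linorder_cases)
    case equal
    then show ?thesis
      using nonneg that by simp
  next
    case less
    have "t \<le> f x / - g x"
      unfolding t_def using bound[OF _ that less] by (intro cSup_least) auto
    then show ?thesis
      using less by (simp add: field_simps)
  next
    case greater
    have "- f x / g x \<le> t"
      unfolding t_def using that greater by (intro cSup_upper[OF _ bdd]) (auto simp: P_def)
    then show ?thesis
      using greater by (simp add: field_simps)
  qed
  ultimately show ?thesis
    by blast
qed

text \<open>Induction with \<open>K\<close> arbitrary: the last constraint is first absorbed into
  the domain, the others get multipliers there, and the partial Lagrangian then takes the role of
  the objective for the last constraint on all of \<open>K\<close>.\<close>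

lemma lagrange_multipliers:
  fixes f :: "'a::real_vector \<Rightarrow> real" and g :: "nat \<Rightarrow> 'a \<Rightarrow> real"
  assumes "convex_on K f" and "\<And>i. i \<in> {1..m} \<Longrightarrow> convex_on K (g i)"
    and "x0 \<in> K" "\<And>i. i \<in> {1..m} \<Longrightarrow> g i x0 < 0"
    and "\<And>x. x \<in> K \<Longrightarrow> \<forall>i\<in>{1..m}. g i x \<le> 0 \<Longrightarrow> f x \<ge> 0"
  shows "\<exists>t. (\<forall>i\<in>{1..m}. t i \<ge> 0) \<and> (\<forall>x\<in>K. f x + (\<Sum>i=1..m. t i * g i x) \<ge> 0)"
  using assms
proof (induction m arbitrary: K)
  case 0
  then show ?case
    by simp
next
  case (Suc m)
  have conv: "convex_on K (g (Suc m))"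
    using Suc.prems by simp
  define K' where "K' = {x \<in> K. g (Suc m) x \<le> 0}"
  have "convex K'"
    unfolding K'_def
  proof (rule convexI)
    fix x y and u v :: real
    assume *: "x \<in> {x \<in> K. g (Suc m) x \<le> 0}" "y \<in> {x \<in> K. g (Suc m) x \<le> 0}"
      "0 \<le> u" "0 \<le> v" "u + v = 1"
    then have "g (Suc m) (u *\<^sub>R x + v *\<^sub>R y) \<le> u * g (Suc m) x + v * g (Suc m) y"
      using conv by (simp add: convex_on_def)
    also have "\<dots> \<le> 0"
      using * by (simp add: add_nonpos_nonpos mult_nonneg_nonpos)
    finally show "u *\<^sub>R x + v *\<^sub>R y \<in> {x \<in> K. g (Suc m) x \<le> 0}"
      using * conv by (simp add: convex_on_def convex_def)
  qed
  then have "convex_on K' f" "\<And>i. i \<in> {1..m} \<Longrightarrow> convex_on K' (g i)"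
    using Suc.prems(1,2) convex_on_subset[of K _ K'] by (simp_all add: K'_def)
  moreover have "x0 \<in> K'"
    using Suc.prems(3) Suc.prems(4)[of "Suc m"] by (simp add: K'_def)
  moreover have "f x \<ge> 0" if "x \<in> K'" "\<forall>i\<in>{1..m}. g i x \<le> 0" for x
    using that Suc.prems(5)[of x] by (auto simp: K'_def atLeastAtMostSuc_conv)
  ultimately obtain t where t: "\<forall>i\<in>{1..m}. t i \<ge> 0"
      "\<forall>x\<in>K'. f x + (\<Sum>i=1..m. t i * g i x) \<ge> 0"
    using Suc.IH[of K'] Suc.prems(4) by force
  have "convex_on K (\<lambda>x. \<Sum>i\<in>I. t i * g i x)" if "finite I" "I \<subseteq> {1..m}" for I
    using that
  proof (induction I)
    case empty
    then show ?case
      using conv by (simp add: convex_on_def)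
  next
    case (insert i I)
    then show ?case
      using t(1) Suc.prems(2)[of i] by (auto intro!: convex_on_add convex_on_cmul)
  qed
  then have "convex_on K (\<lambda>x. f x + (\<Sum>i=1..m. t i * g i x))"
    using Suc.prems(1) by (intro convex_on_add) auto
  then have "\<exists>r\<ge>0. \<forall>x\<in>K. f x + (\<Sum>i=1..m. t i * g i x) + r * g (Suc m) x \<ge> 0"
    using conv Suc.prems(3)
  proof (rule lagrange_multiplier_single)
    show "g (Suc m) x0 < 0"
      using Suc.prems(4) by simp
    show "f x + (\<Sum>i=1..m. t i * g i x) \<ge> 0" if "x \<in> K" "g (Suc m) x \<le> 0" for x
      using that t(2) by (simp add: K'_def)
  qed
  then obtain r where r: "r \<ge> 0"
    "\<forall>x\<in>K. f x + (\<Sum>i=1..m. t i * g i x) + r * g (Suc m) x \<ge> 0"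
    by blast
  have "(\<Sum>i=1..m. (t(Suc m := r)) i * g i x) = (\<Sum>i=1..m. t i * g i x)" for x
    by (intro sum.cong) auto
  then show ?case
    using r t(1) by (intro exI[of _ "t(Suc m := r)"]) (auto simp: add.assoc)
qed

section \<open>Quadratic forms of matrices and the equivalence\<close>

lemma sum_atLeast1_atMost3: "(\<Sum>j=1..3. f j) = f 1 + f 2 + f (3 :: nat)"
  by (simp add: eval_nat_numeral)

lemma quad_form_add: "quad_form (A + B) x = quad_form A x + quad_form B x"
  by (simp add: quad_form_def matrix_vector_mult_add_rdistrib inner_add_right)

lemma quad_form_scaleR: "quad_form (c *\<^sub>R A) x = c * quad_form A x"
  by (simp add: quad_form_def flip: scaleR_matrix_vector_assoc)

lemma quad_form_sum: "quad_form (\<Sum>i\<in>I. A i) x = (\<Sum>i\<in>I. quad_form (A i) x)"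
proof (induction I rule: infinite_finite_induct)
qed (simp_all add: quad_form_add, simp_all add: quad_form_def)

lemma symmetric_matrix_sum:
  assumes "\<And>i. i \<in> I \<Longrightarrow> symmetric_matrix (A i)"
  shows "symmetric_matrix (\<Sum>i\<in>I. A i)"
  using assms by (simp add: symmetric_matrix_def transpose_def vec_eq_iff)

theorem theorem10:
  fixes A B :: "nat \<Rightarrow> real ^ 'n ^ 'n"
    and \<beta> :: "nat \<Rightarrow> real"
    and m :: nat
  assumes "CARD('n) \<ge> 3" and "m \<ge> 1"
    and "\<forall>i\<in>{0..m}. symmetric_matrix (B i)"
    and "\<forall>j\<in>{1..3}. symmetric_matrix (A j)"
    and "\<exists>r :: nat \<Rightarrow> nat \<Rightarrow> real. \<forall>i\<in>{0..m}. B i = (\<Sum>j=1..3. r i j *\<^sub>R A j)"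
    and "\<exists>s :: nat \<Rightarrow> real. pos_def (\<Sum>j=1..3. s j *\<^sub>R A j)"
    and "\<exists>x. \<forall>i\<in>{1..m}. quad_form (B i) x < \<beta> i"
  shows "(\<forall>x. (\<forall>i\<in>{1..m}. quad_form (B i) x \<le> \<beta> i) \<longrightarrow> quad_form (B 0) x \<ge> \<beta> 0) \<longleftrightarrow>
    (\<exists>t :: nat \<Rightarrow> real. (\<forall>i\<in>{1..m}. t i \<ge> 0) \<and>
       pos_semidef (B 0 + (\<Sum>i=1..m. t i *\<^sub>R B i)) \<and>
       \<beta> 0 + (\<Sum>i=1..m. t i * \<beta> i) \<le> 0)"
    (is "?e \<longleftrightarrow> ?f")
proof
  assume ?f
  then obtain t where t: "\<forall>i\<in>{1..m}. t i \<ge> 0"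
    "pos_semidef (B 0 + (\<Sum>i=1..m. t i *\<^sub>R B i))" "\<beta> 0 + (\<Sum>i=1..m. t i * \<beta> i) \<le> 0"
    by blast
  show ?e
  proof (intro allI impI)
    fix x
    assume "\<forall>i\<in>{1..m}. quad_form (B i) x \<le> \<beta> i"
    then have "(\<Sum>i=1..m. t i * quad_form (B i) x) \<le> (\<Sum>i=1..m. t i * \<beta> i)"
      using t(1) by (intro sum_mono mult_left_mono) auto
    moreover have "0 \<le> quad_form (B 0) x + (\<Sum>i=1..m. t i * quad_form (B i) x)"
      using t(2) by (simp add: pos_semidef_def quad_form_add quad_form_sum quad_form_scaleR)
    ultimately show "\<beta> 0 \<le> quad_form (B 0) x"
      using t(3) by linarith
  qed
next
  assume e: ?e
  obtain r where r: "\<forall>i\<in>{0..m}. B i = (\<Sum>j=1..3. r i j *\<^sub>R A j)"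
    using assms(5) by blast
  obtain s where s: "pos_def (\<Sum>j=1..3. s j *\<^sub>R A j)"
    using assms(6) by blast
  obtain x0 where x0: "\<forall>i\<in>{1..m}. quad_form (B i) x0 < \<beta> i"
    using assms(7) by blast
  define h :: "real ^ 'n \<Rightarrow> real ^ 'n \<Rightarrow> real ^ 3"
    where "h u v = vector [u \<bullet> (A 1 *v v), u \<bullet> (A 2 *v v), u \<bullet> (A 3 *v v)]" for u v
  \<comment> \<open>Turns a combination of the \<open>A j\<close> into a linear functional on the
    joint range, so that the constraints become affine there.\<close>
  define L where "L c v = c 1 * v $ 1 + c 2 * v $ 2 + c 3 * v $ 3"
    for c :: "nat \<Rightarrow> real" and v :: "real ^ 3"
  have L_quad: "L c (h x x) = quad_form (\<Sum>j=1..3. c j *\<^sub>R A j) x" for c x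
    unfolding sum_atLeast1_atMost3 quad_form_add quad_form_scaleR
    by (simp add: L_def h_def quad_form_def)
  have L_lin: "linear (L c)" for c
    unfolding L_def by (intro linearI) (simp_all add: algebra_simps)
  have BL: "quad_form (B i) x = L (r i) (h x x)" if "i \<in> {0..m}" for i x
    using r that by (simp add: L_quad)
  have h_bil: "bilinear h"
    unfolding bilinear_def h_def
    by (auto intro!: linearI simp: vec_eq_iff forall_3 matrix_vector_right_distrib
        inner_add_left inner_add_right matrix_vector_mult_scaleR)
  have h_sym: "h u v = h v u" for u v
  proof -
    have "u \<bullet> (A j *v v) = v \<bullet> (A j *v u)" if "j \<in> {1..3}" for j
    proof -
      have "transpose (A j) = A j"
        using assms(4) that by (simp add: symmetric_matrix_def)
      then have "u \<bullet> (A j *v v) = (A j *v u) \<bullet> v"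
        by (metis dot_lmul_matrix vector_transpose_matrix)
      then show ?thesis
        by (simp add: inner_commute)
    qed
    then show ?thesis
      by (simp add: h_def)
  qed
  define K where "K = range (\<lambda>x. h x x)"
  have "convex_cone K"
    unfolding convex_cone_iff
  proof (intro conjI ballI allI impI)
    show "0 \<in> K"
      unfolding K_def using rangeI[of "\<lambda>x. h x x" 0] bilinear_lzero[OF h_bil] by simp
    show "v + w \<in> K" if "v \<in> K" "w \<in> K" for v w
    proof -
      obtain x y where xy: "v = h x x" "w = h y y"
        using \<open>v \<in> K\<close> \<open>w \<in> K\<close> by (auto simp: K_def)
      have "L s (h z z) > 0" if "z \<noteq> 0" for z
        using s that by (simp add: L_quad pos_def_def)
      then obtain z where "h z z = h x x + h y y"
        using joint_range_add[OF _ h_bil h_sym L_lin, of s x y] assms(1) by auto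
      then show ?thesis
        unfolding K_def xy using rangeI[of "\<lambda>x. h x x" z] by simp
    qed
    show "c *\<^sub>R v \<in> K" if "v \<in> K" "c \<ge> 0" for v c
    proof -
      obtain x where x: "v = h x x"
        using \<open>v \<in> K\<close> by (auto simp: K_def)
      have "h (sqrt c *\<^sub>R x) (sqrt c *\<^sub>R x) = c *\<^sub>R v"
        using that by (simp add: x bilinear_lmul[OF h_bil] bilinear_rmul[OF h_bil])
      then show ?thesis
        unfolding K_def using rangeI[of "\<lambda>x. h x x" "sqrt c *\<^sub>R x"] by simp
    qed
  qed
  then have K: "convex K" "\<And>v c. v \<in> K \<Longrightarrow> c \<ge> 0 \<Longrightarrow> c *\<^sub>R v \<in> K" "0 \<in> K"
    by (auto simp: convex_cone_def convex_cone_iff conic_def convex_cone_contains_0)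
  have conv: "convex_on K (\<lambda>v. L c v - b)" for c b
    by (intro convex_onI K(1))
      (simp add: linear_add[OF L_lin] linear_diff[OF L_lin] linear_scale[OF L_lin] algebra_simps)
  have "\<exists>t. (\<forall>i\<in>{1..m}. t i \<ge> 0) \<and>
      (\<forall>v\<in>K. (L (r 0) v - \<beta> 0) + (\<Sum>i=1..m. t i * (L (r i) v - \<beta> i)) \<ge> 0)"
  proof (rule lagrange_multipliers[OF conv conv])
    show "h x0 x0 \<in> K"
      by (simp add: K_def)
    show "L (r i) (h x0 x0) - \<beta> i < 0" if "i \<in> {1..m}" for i
      using bspec[OF x0 that] that BL[of i x0] by simp
    show "L (r 0) v - \<beta> 0 \<ge> 0" if "v \<in> K" "\<forall>i\<in>{1..m}. L (r i) v - \<beta> i \<le> 0" for v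
    proof -
      obtain x where "v = h x x"
        using \<open>v \<in> K\<close> by (auto simp: K_def)
      then show ?thesis
        using e[rule_format, of x] that(2) by (simp add: BL)
    qed
  qed
  then obtain t where t: "\<forall>i\<in>{1..m}. t i \<ge> 0"
    "\<And>v. v \<in> K \<Longrightarrow> (L (r 0) v - \<beta> 0) + (\<Sum>i=1..m. t i * (L (r i) v - \<beta> i)) \<ge> 0"
    by blast
  \<comment> \<open>The Lagrangian on \<open>K\<close> is \<open>M v - b\<close>, with
    \<open>M\<close> homogeneous; evaluating at the apex 0 of the cone gives
    \<open>b \<le> 0\<close>.\<close>
  define M where "M v = L (r 0) v + (\<Sum>i=1..m. t i * L (r i) v)" for v
  define b where "b = \<beta> 0 + (\<Sum>i=1..m. t i * \<beta> i)"
  have M: "M v \<ge> b" if "v \<in> K" for v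
    using t(2)[OF that] by (simp add: M_def b_def right_diff_distrib sum_subtractf)
  have M_scale: "M (c *\<^sub>R v) = c * M v" for c v
    by (simp add: M_def linear_scale[OF L_lin] distrib_left sum_distrib_left mult.left_commute)
  have "b \<le> 0"
    using M[OF K(3)] M_scale[of 0 0] by simp
  moreover have "M v \<ge> 0" if "v \<in> K" for v
  proof (rule ccontr)
    assume "\<not> M v \<ge> 0"
    \<comment> \<open>The scaling factor is chosen so that \<open>M\<close> takes the value
      \<open>b + M v\<close> on the ray, which lies below its lower bound \<open>b\<close>.\<close>
    then have "b / M v \<ge> 0" "M ((b / M v + 1) *\<^sub>R v) = b + M v"
      using \<open>b \<le> 0\<close> by (simp_all add: M_scale divide_nonpos_neg distrib_right)
    then show False
      using M[OF K(2)[OF that, of "b / M v + 1"]] \<open>\<not> M v \<ge> 0\<close> by simp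
  qed
  then have "quad_form (B 0 + (\<Sum>i=1..m. t i *\<^sub>R B i)) x \<ge> 0" for x
    by (simp add: quad_form_add quad_form_sum quad_form_scaleR BL M_def K_def)
  moreover have "symmetric_matrix (B 0 + (\<Sum>i=1..m. t i *\<^sub>R B i))"
  proof -
    have "symmetric_matrix (\<Sum>i=1..m. t i *\<^sub>R B i)"
      using assms(3) by (intro symmetric_matrix_sum) (simp add: symmetric_matrix_def transpose_scalar)
    then show ?thesis
      using assms(3) by (simp add: symmetric_matrix_def transpose_def vec_eq_iff)
  qed
  ultimately show ?f
    using t(1) by (auto simp: pos_semidef_def b_def)
qed

end
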